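(* Let $d>2$ and $2\leq s\leq d$ be integers, and let $\mathsf{h}=(1,h_1,\ldots,h_{s-1})$ and $\mathsf{k}=(1,k_1,\ldots,k_{s-1})$ be two O-sequences in $\mathcal{G}_d^s$. If $\mathsf{k}<\mathsf{h}$ and $g(\mathsf{k})>g(\mathsf{h})$, then there is an O-sequence $\bar{\mathsf{h}}\in\mathcal{G}_d^s$ such that $\bar{\mathsf{h}}>\mathsf{h}$ and $g(\bar{\mathsf{h}})>g(\mathsf{k})$. Thus, $\max(G_d^s)=g(\max(\mathcal{G}_d^s))$, where $\max(\mathcal{G}_d^s)$ is taken with respect to the total order $<$.
   Context: Binomial expansion: for positive integers $a,t$ write uniquely $a=\binom{k(t)}{t}+\binom{k(t-1)}{t-1}+\cdots+\binom{k(j)}{j}$ with $k(t)>k(t-1)>\cdots>k(j)\geq j\geq 1$, and set $a^{\langle t\rangle}:=\binom{k(t)+1}{t+1}+\binom{k(t-1)+1}{t}+\cdots+\binom{k(j)+1}{j+1}$; also $0^{\langle t\rangle}:=0$. A function $\mathsf{h}:\mathbb{N}\to\mathbb{N}$ is an O-sequence if $\mathsf{h}(0)=1$ and $\mathsf{h}(t+1)\leq \mathsf{h}(t)^{\langle t\rangle}$ for every $t\geq 1$. It is finite if $\mathsf{h}(t)=0$ for some $t$ (and then for all larger arguments); a finite O-sequence is written $(h_0,\ldots,h_{s-1})$ with $h_{s-1}\neq 0$, $s$ is its length, and $e(\mathsf{h})=\sum_{i=0}^{s-1}h_i$ is its multiplicity. $\mathcal{G}_d^s$ is the set of finite O-sequences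 of multiplicity $d$ and length $s$. The genus of a finite O-sequence $\mathsf{h}=(h_0,\ldots,h_{s-1})$ is $g(\mathsf{h}):=\sum_{j=2}^{s-1}(j-1)h_j$, and $G_d^s:=\{g(\mathsf{h})\mid\mathsf{h}\in\mathcal{G}_d^s\}$. Total order $<$ on $\mathcal{G}_d^s$: for distinct $\mathsf{h}=(1,h_1,\ldots,h_{s-1})$ and $\mathsf{h}'=(1,h_1',\ldots,h_{s-1}')$, $\mathsf{h}<\mathsf{h}'$ if $h_\ell<h'_\ell$, where $\ell:=\max\{j: h_j\neq h_j'\}$. *)

theory Defs
  imports Complex_Main
begin

text \<open>
  Binomial expansion of \<open>a\<close> in base \<open>t\<close>: the numerators are the values of \<open>k\<close> on \<open>{j..t}\<close>; the
  values of \<open>k\<close> elsewhere are irrelevant.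
\<close>

definition binomial_expansion :: "nat \<Rightarrow> nat \<Rightarrow> nat \<Rightarrow> (nat \<Rightarrow> nat) \<Rightarrow> bool" where
  "binomial_expansion t a j k \<longleftrightarrow>
     1 \<le> j \<and> j \<le> t \<and> j \<le> k j \<and> strict_mono_on {j..t} k \<and> a = (\<Sum>i=j..t. k i choose i)"

text \<open>
  The number \<open>a\<^bsup>\<langle>t\<rangle>\<^esup>\<close>. It is only meaningful for \<open>t \<ge> 1\<close>, where the description below determines it
  (\<open>binomial_expansion_exists\<close>, \<open>binomial_expansion_unique\<close>).
\<close>

definition macaulay :: "nat \<Rightarrow> nat \<Rightarrow> nat" where
  "macaulay t a =
     (if a = 0 then 0
      else THE b. \<exists>j k. binomial_expansion t a j k \<and> b = (\<Sum>i=j..t. (k i + 1) choose (i + 1)))"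

definition O_sequence :: "(nat \<Rightarrow> nat) \<Rightarrow> bool" where
  "O_sequence h \<longleftrightarrow> h 0 = 1 \<and> (\<forall>t\<ge>1. h (t + 1) \<le> macaulay t (h t))"

definition finite_O_sequence :: "(nat \<Rightarrow> nat) \<Rightarrow> bool" where
  "finite_O_sequence h \<longleftrightarrow> O_sequence h \<and> (\<exists>t. h t = 0)"

text \<open>
  Once an O-sequence vanishes it stays zero (\<open>O_sequence_zero\<close>), so for a finite O-sequence
  \<open>(h 0, \<dots>, h (s - 1))\<close> with \<open>h (s - 1) \<noteq> 0\<close> the length \<open>s\<close> is the first zero of \<open>h\<close>.
\<close>

definition O_length :: "(nat \<Rightarrow> nat) \<Rightarrow> nat" where
  "O_length h = (LEAST t. h t = 0)"

definition multiplicity :: "(nat \<Rightarrow> nat) \<Rightarrow> nat" where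
  "multiplicity h = (\<Sum>i<O_length h. h i)"

definition genus :: "(nat \<Rightarrow> nat) \<Rightarrow> nat" where
  "genus h = (\<Sum>j=2..<O_length h. (j - 1) * h j)"

definition O_seqs :: "nat \<Rightarrow> nat \<Rightarrow> (nat \<Rightarrow> nat) set" where
  "O_seqs d s = {h. finite_O_sequence h \<and> multiplicity h = d \<and> O_length h = s}"

definition genera :: "nat \<Rightarrow> nat \<Rightarrow> nat set" where
  "genera d s = genus ` O_seqs d s"

text \<open>On \<open>O_seqs d s\<close> the set of indices where two sequences differ is finite.\<close>

definition O_less :: "(nat \<Rightarrow> nat) \<Rightarrow> (nat \<Rightarrow> nat) \<Rightarrow> bool" where
  "O_less h h' \<longleftrightarrow> h \<noteq> h' \<and> (let l = Max {j. h j \<noteq> h' j} in h l < h' l)"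

definition O_max :: "nat \<Rightarrow> nat \<Rightarrow> (nat \<Rightarrow> nat)" where
  "O_max d s = (THE m. m \<in> O_seqs d s \<and> (\<forall>h\<in>O_seqs d s. h \<noteq> m \<longrightarrow> O_less h m))"


subsection \<open>The definitions above are meaningful\<close>

lemma binomial_expansion_le:
  assumes "binomial_expansion t a j k" "i \<in> {j..t}"
  shows "i \<le> k i"
proof -
  have "j \<le> i" using assms by simp
  then show ?thesis using assms(2)
  proof (induction i rule: dec_induct)
    case base then show ?case using assms(1) by (simp add: binomial_expansion_def)
  next
    case (step n)
    have "k n < k (Suc n)"
      using assms(1) step unfolding binomial_expansion_def strict_mono_on_def by auto
    with step show ?case by simp
  qed
qed

lemma choose_Suc_less: "1 \<le> t \<Longrightarrow> t \<le> n + 1 \<Longrightarrow> (n choose t) < (Suc n choose t)"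
  by (cases t) (auto simp: zero_less_binomial_iff)

lemma binomial_expansion_Suc:
  assumes "binomial_expansion (Suc t) a j k" "j \<le> t"
  shows "binomial_expansion t (a - (k (Suc t) choose Suc t)) j k"
    and "k t < k (Suc t)" and "0 < a - (k (Suc t) choose Suc t)"
    and "a = (k (Suc t) choose Suc t) + (a - (k (Suc t) choose Suc t))"
proof -
  have a: "a = (k (Suc t) choose Suc t) + (\<Sum>i=j..t. k i choose i)"
    using assms by (simp add: binomial_expansion_def)
  then show e: "binomial_expansion t (a - (k (Suc t) choose Suc t)) j k"
    using assms unfolding binomial_expansion_def strict_mono_on_def by auto
  show "k t < k (Suc t)"
    using assms unfolding binomial_expansion_def strict_mono_on_def by auto
  have "0 < (k t choose t)"
    using binomial_expansion_le[OF e, of t] assms(2) by (simp add: zero_less_binomial)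
  also have "\<dots> \<le> (\<Sum>i=j..t. k i choose i)"
    using assms(2) by (intro member_le_sum) auto
  finally show "0 < a - (k (Suc t) choose Suc t)" using a by simp
  show "a = (k (Suc t) choose Suc t) + (a - (k (Suc t) choose Suc t))" using a by simp
qed

lemma binomial_expansion_top:
  assumes "binomial_expansion t a j k"
  shows "(k t choose t) \<le> a \<and> a < (Suc (k t) choose t)"
  using assms
proof (induction t arbitrary: a)
  case 0 then show ?case unfolding binomial_expansion_def by linarith
next
  case (Suc t)
  have le: "Suc t \<le> k (Suc t)"
    using binomial_expansion_le[OF Suc.prems, of "Suc t"] Suc.prems
    by (simp add: binomial_expansion_def)
  show ?case
  proof (cases "j \<le> t")
    case True
    note s = binomial_expansion_Suc[OF Suc.prems True]
    have "a - (k (Suc t) choose Suc t) < (Suc (k t) choose t)" using Suc.IH[OF s(1)] by simp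
    also have "\<dots> \<le> (k (Suc t) choose t)" using s(2) by (intro binomial_right_mono) simp
    finally show ?thesis using s(4) by simp
  next
    case False
    then have "a = (k (Suc t) choose Suc t)" using Suc.prems by (auto simp: binomial_expansion_def le_Suc_eq)
    then show ?thesis using choose_Suc_less[of "Suc t" "k (Suc t)"] le by simp
  qed
qed

lemma binomial_expansion_unique:
  assumes "binomial_expansion t a j k" "binomial_expansion t a j' k'"
  shows "j = j' \<and> (\<forall>i\<in>{j..t}. k i = k' i)"
  using assms
proof (induction t arbitrary: a)
  case 0 then show ?case unfolding binomial_expansion_def by linarith
next
  case (Suc t)
  note top = binomial_expansion_top[OF Suc.prems(1)] binomial_expansion_top[OF Suc.prems(2)]
  have eq: "k (Suc t) = k' (Suc t)"
  proof (rule ccontr)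
    assume "k (Suc t) \<noteq> k' (Suc t)"
    then consider "Suc (k (Suc t)) \<le> k' (Suc t)" | "Suc (k' (Suc t)) \<le> k (Suc t)" by linarith
    then show False
      using top binomial_right_mono[of "Suc (k (Suc t))" "k' (Suc t)" "Suc t"]
        binomial_right_mono[of "Suc (k' (Suc t))" "k (Suc t)" "Suc t"] by cases linarith+
  qed
  have lt: "j = Suc t \<and> a = (k (Suc t) choose Suc t)" if "\<not> j \<le> t"
    using Suc.prems(1) that by (auto simp: binomial_expansion_def le_Suc_eq)
  have lt': "j' = Suc t \<and> a = (k' (Suc t) choose Suc t)" if "\<not> j' \<le> t"
    using Suc.prems(2) that by (auto simp: binomial_expansion_def le_Suc_eq)
  show ?case
  proof (cases "j \<le> t")
    case True
    note s = binomial_expansion_Suc[OF Suc.prems(1) True]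
    have T': "j' \<le> t" using lt' s(3) eq by fastforce
    note s' = binomial_expansion_Suc[OF Suc.prems(2) T']
    show ?thesis using Suc.IH[OF s(1)] s'(1) eq by (auto simp: le_Suc_eq)
  next
    case False
    have "\<not> j' \<le> t" using lt[OF False] binomial_expansion_Suc(3)[OF Suc.prems(2)] eq by fastforce
    then show ?thesis using lt[OF False] lt' eq by auto
  qed
qed

lemma binomial_expansion_exists:
  assumes "1 \<le> t" "1 \<le> a"
  shows "\<exists>j k. binomial_expansion t a j k"
  using assms
proof (induction t arbitrary: a)
  case 0 then show ?case by simp
next
  case (Suc t)
  define P where "P n \<longleftrightarrow> (n choose Suc t) \<le> a" for n
  have bd: "n \<le> a + Suc t" if "P n" for n
  proof (rule ccontr)
    assume "\<not> n \<le> a + Suc t"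
    then have n: "a + Suc t < n" by simp
    have le: "m + 1 \<le> (m + Suc t choose Suc t)" for m
    proof (induction m)
      case (Suc m)
      have "(m + Suc t choose Suc t) < (Suc (m + Suc t) choose Suc t)"
        by (intro choose_Suc_less) auto
      then show ?case using Suc by (simp del: binomial_Suc_Suc)
    qed simp
    have "n - Suc t + 1 \<le> (n choose Suc t)" using le[of "n - Suc t"] n by (simp del: binomial_Suc_Suc)
    then show False using n that unfolding P_def by linarith
  qed
  have P0: "P (Suc t)" using Suc.prems by (simp add: P_def)
  define n where "n = Greatest P"
  have Pn: "P n" unfolding n_def by (rule GreatestI_nat[of P]) (use P0 bd in auto)
  have max: "m \<le> n" if "P m" for m
    unfolding n_def by (rule Greatest_le_nat[of P]) (use that bd in auto)
  have tn: "Suc t \<le> n" using max[OF P0] .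
  define r where "r = a - (n choose Suc t)"
  have ar: "a = (n choose Suc t) + r" using Pn by (simp add: r_def P_def)
  have "\<not> P (Suc n)" using max[of "Suc n"] by auto
  then have r: "r < (n choose t)" using ar by (simp add: P_def)
  show ?case
  proof (cases "r = 0")
    case True
    then have "binomial_expansion (Suc t) a (Suc t) (\<lambda>_. n)"
      using ar tn by (simp add: binomial_expansion_def strict_mono_on_def)
    then show ?thesis by blast
  next
    case False
    then have "1 \<le> t" using r by (cases t) auto
    then obtain j k where jk: "binomial_expansion t r j k" using Suc.IH[of r] False by auto
    have kn: "k t < n"
    proof (rule ccontr)
      assume "\<not> k t < n"
      then have "(n choose t) \<le> (k t choose t)" by (intro binomial_right_mono) simp
      then show False using binomial_expansion_top[OF jk] r by simp
    qed
    have kt: "k i \<le> k t" if "j \<le> i" "i \<le> t" for i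
      using jk that unfolding binomial_expansion_def strict_mono_on_def
      by (cases "i = t") (auto simp: less_imp_le)
    have "binomial_expansion (Suc t) a j (k(Suc t := n))"
      using jk ar kn kt unfolding binomial_expansion_def strict_mono_on_def
      by (auto simp: le_Suc_eq intro: le_less_trans)
    then show ?thesis by blast
  qed
qed

lemma macaulay_eq:
  assumes "binomial_expansion t a j k" "a \<noteq> 0"
  shows "macaulay t a = (\<Sum>i=j..t. (k i + 1) choose (i + 1))"
proof -
  have "(THE b. \<exists>j k. binomial_expansion t a j k \<and> b = (\<Sum>i=j..t. (k i + 1) choose (i + 1)))
      = (\<Sum>i=j..t. (k i + 1) choose (i + 1))"
  proof (rule the_equality)
    fix b assume "\<exists>j k. binomial_expansion t a j k \<and> b = (\<Sum>i=j..t. (k i + 1) choose (i + 1))"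
    then obtain j' k' where "binomial_expansion t a j' k'"
      and b: "b = (\<Sum>i=j'..t. (k' i + 1) choose (i + 1))" by blast
    from binomial_expansion_unique[OF assms(1) this(1)] b
    show "b = (\<Sum>i=j..t. (k i + 1) choose (i + 1))" by (auto intro!: sum.cong)
  qed (use assms in blast)
  then show ?thesis using assms by (simp add: macaulay_def)
qed

lemma O_sequence_zero:
  assumes "O_sequence h" "h t = 0" "t \<le> u"
  shows "h u = 0"
  using assms(3)
proof (induction u rule: dec_induct)
  case base show ?case using assms by simp
next
  case (step n)
  have "n \<noteq> 0" using step assms by (cases n) (auto simp: O_sequence_def)
  then show ?case using step assms(1) by (auto simp: O_sequence_def macaulay_def dest!: spec[of _ n])
qed

lemma O_seqs_iff:
  assumes "1 \<le> s"
  shows "h \<in> O_seqs d s \<longleftrightarrow>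
    O_sequence h \<and> h (s - 1) \<noteq> 0 \<and> (\<forall>i\<ge>s. h i = 0) \<and> (\<Sum>i<s. h i) = d"
proof
  assume h: "h \<in> O_seqs d s"
  then have O: "O_sequence h" and ex: "\<exists>t. h t = 0" and s: "O_length h = s"
    and m: "multiplicity h = d" by (auto simp: O_seqs_def finite_O_sequence_def)
  have "h s = 0" using LeastI_ex[OF ex] s by (simp add: O_length_def)
  moreover have "h (s - 1) \<noteq> 0"
    using not_less_Least[of "s - 1" "\<lambda>t. h t = 0"] s assms by (simp add: O_length_def)
  ultimately show "O_sequence h \<and> h (s - 1) \<noteq> 0 \<and> (\<forall>i\<ge>s. h i = 0) \<and> (\<Sum>i<s. h i) = d"
    using O O_sequence_zero[OF O] m s by (auto simp: multiplicity_def)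
next
  assume h: "O_sequence h \<and> h (s - 1) \<noteq> 0 \<and> (\<forall>i\<ge>s. h i = 0) \<and> (\<Sum>i<s. h i) = d"
  have "s \<le> y" if "h y = 0" for y
    using O_sequence_zero[of h y "s - 1"] h that by (metis One_nat_def Suc_pred assms less_eq_Suc_le not_less_eq_eq)
  then have "O_length h = s" unfolding O_length_def using h by (intro Least_equality) auto
  then show "h \<in> O_seqs d s"
    using h by (auto simp: O_seqs_def finite_O_sequence_def multiplicity_def)
qed

lemma finite_O_seqs:
  assumes "1 \<le> s"
  shows "finite (O_seqs d s)"
proof (rule finite_subset)
  show "O_seqs d s \<subseteq> {h. \<forall>i. (i \<in> {..<s} \<longrightarrow> h i \<in> {..d}) \<and> (i \<notin> {..<s} \<longrightarrow> h i = 0)}"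
    using assms by (auto simp: O_seqs_iff intro!: member_le_sum)
qed (intro finite_set_of_finite_funs, auto)

lemma O_seqs_nonempty:
  assumes "2 \<le> s" "s \<le> d"
  shows "O_seqs d s \<noteq> {}"
proof -
  define h where "h i = (if s \<le> i then 0 else if i = 1 then d - s + 1 else 1)" for i
  have "h (t + 1) \<le> macaulay t (h t)" if t: "1 \<le> t" for t
  proof (cases "t + 1 < s")
    case True
    then have pos: "h t \<noteq> 0" by (auto simp: h_def)
    then obtain j k where e: "binomial_expansion t (h t) j k"
      using binomial_expansion_exists[OF t, of "h t"] by auto
    have "0 < ((k t + 1) choose (t + 1))"
      using binomial_expansion_le[OF e, of t] e
      by (simp add: zero_less_binomial_iff binomial_expansion_def del: binomial_Suc_Suc)
    also have "\<dots> \<le> macaulay t (h t)"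
      unfolding macaulay_eq[OF e pos] using e by (intro member_le_sum) (auto simp: binomial_expansion_def)
    finally show ?thesis using True t by (simp add: h_def)
  qed (simp add: h_def)
  moreover have "(\<Sum>i<s. h i) = d"
  proof -
    have "(\<Sum>i<s. h i) = (\<Sum>i<s. 1 + (if i = 1 then d - s else 0))"
      using assms by (intro sum.cong) (auto simp: h_def)
    also have "\<dots> = (\<Sum>i<s. 1) + (\<Sum>i<s. if i = 1 then d - s else 0)"
      by (rule sum.distrib)
    also have "\<dots> = d" using assms by (simp add: sum.delta)
    finally show ?thesis .
  qed
  ultimately have "h \<in> O_seqs d s"
    using assms by (auto simp: O_seqs_iff O_sequence_def h_def)
  then show ?thesis by blast
qed

lemma O_less_iff:
  assumes "1 \<le> s" "h \<in> O_seqs d s" "h' \<in> O_seqs d s"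
  shows "O_less h h' \<longleftrightarrow> (\<exists>l. h l < h' l \<and> (\<forall>i>l. h i = h' i))"
proof -
  let ?D = "{j. h j \<noteq> h' j}"
  have fin: "finite ?D"
  proof (rule finite_subset)
    show "?D \<subseteq> {..<s}" using assms by (auto simp: O_seqs_iff) (metis not_le)
  qed simp
  show ?thesis
  proof
    assume "O_less h h'"
    then have "h (Max ?D) < h' (Max ?D)" by (simp add: O_less_def Let_def)
    moreover have "\<forall>i>Max ?D. h i = h' i" using Max_ge[OF fin] by (auto dest: leD)
    ultimately show "\<exists>l. h l < h' l \<and> (\<forall>i>l. h i = h' i)" by blast
  next
    assume "\<exists>l. h l < h' l \<and> (\<forall>i>l. h i = h' i)"
    then obtain l where l: "h l < h' l" "\<forall>i>l. h i = h' i" by blast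
    have "Max ?D = l" using l fin by (intro Max_eqI) (auto intro: leI)
    then show "O_less h h'" using l by (auto simp: O_less_def Let_def)
  qed
qed

lemma O_less_linear:
  assumes "1 \<le> s" "h \<in> O_seqs d s" "h' \<in> O_seqs d s" "h \<noteq> h'"
  shows "O_less h h' \<longleftrightarrow> \<not> O_less h' h"
proof -
  let ?D = "{j. h j \<noteq> h' j}"
  have "?D \<subseteq> {..<s}" using assms by (auto simp: O_seqs_iff)
  then have "finite ?D" by (rule finite_subset) simp
  moreover have "?D \<noteq> {}" using assms(4) by auto
  ultimately have "Max ?D \<in> ?D" by (rule Max_in)
  moreover have "{j. h' j \<noteq> h j} = ?D" by auto
  ultimately show ?thesis using assms(4) by (auto simp: O_less_def Let_def)
qed

lemma O_less_trans:
  assumes "1 \<le> s" "h \<in> O_seqs d s" "h' \<in> O_seqs d s" "h'' \<in> O_seqs d s"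
    and "O_less h h'" "O_less h' h''"
  shows "O_less h h''"
proof -
  obtain l m where "h l < h' l" "\<forall>i>l. h i = h' i" "h' m < h'' m" "\<forall>i>m. h' i = h'' i"
    using assms by (auto simp: O_less_iff)
  then have "h (max l m) < h'' (max l m) \<and> (\<forall>i>max l m. h i = h'' i)"
    by (cases l m rule: linorder_cases) (auto simp: max_def)
  then show ?thesis using assms by (auto simp: O_less_iff)
qed

lemma O_max_unique:
  assumes "2 \<le> s" "s \<le> d"
  shows "\<exists>!m. m \<in> O_seqs d s \<and> (\<forall>h\<in>O_seqs d s. h \<noteq> m \<longrightarrow> O_less h m)"
proof -
  have s: "1 \<le> s" using assms by simp
  have "\<exists>m\<in>A. \<forall>h\<in>A. h \<noteq> m \<longrightarrow> O_less h m"
    if "finite A" "A \<noteq> {}" "A \<subseteq> O_seqs d s" for A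
    using that
  proof (induction A rule: finite_ne_induct)
    case (insert x A)
    then obtain m where m: "m \<in> A" "\<forall>h\<in>A. h \<noteq> m \<longrightarrow> O_less h m" by auto
    have "x \<noteq> m" using insert m by auto
    then consider "O_less x m" | "O_less m x"
      using O_less_linear[OF s, of x d m] insert.prems m by auto
    then show ?case
    proof cases
      case 2
      have "\<forall>h\<in>A. O_less h x"
        using m 2 insert.prems O_less_trans[OF s, of _ d m x] by (metis insert_subset subsetD)
      then show ?thesis by auto
    qed (use m in auto)
  qed auto
  from this[OF finite_O_seqs[OF s] O_seqs_nonempty[OF assms]]
  show ?thesis using O_less_linear[OF s] by (metis order_refl)
qed

end

theory Submission
  imports Defs
begin

text \<open>
  The greatest sequence \<open>m\<close> is the only maximiser of the genus. Given \<open>k \<noteq> m\<close>, let \<open>j\<close> be the last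
  index with \<open>k j > m j\<close> and \<open>q > j\<close> the first later index with \<open>k q < m q\<close>. Monotonicity of
  \<open>a \<mapsto> a\<^bsup>\<langle>t\<rangle>\<^esup>\<close> shows, by comparison with \<open>m\<close>, that moving one unit from degree \<open>j\<close> to degree \<open>q\<close>
  gives another O-sequence; its genus is larger by \<open>q - j\<close>. Hence \<open>m\<close> itself serves as the
  required sequence above \<open>h\<close>.
\<close>

text \<open>Reindexing turns the sum that gives the Macaulay value into an expansion in base
  \<open>Suc t\<close>, so \<open>binomial_expansion_top\<close> bounds that value as well.\<close>

lemma binomial_expansion_shift:
  assumes "binomial_expansion t a j k"
  shows "binomial_expansion (Suc t) (\<Sum>i=j..t. Suc (k i) choose Suc i) (Suc j) (\<lambda>i. Suc (k (i - 1)))"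
proof -
  have "strict_mono_on {Suc j..Suc t} (\<lambda>i. Suc (k (i - 1)))"
  proof (rule strict_mono_onI)
    fix r s assume "r \<in> {Suc j..Suc t}" "s \<in> {Suc j..Suc t}" "r < s"
    then have "r - 1 \<in> {j..t}" "s - 1 \<in> {j..t}" "r - 1 < s - 1" by auto
    then show "Suc (k (r - 1)) < Suc (k (s - 1))"
      using assms unfolding binomial_expansion_def strict_mono_on_def by simp
  qed
  moreover have "(\<Sum>i=j..t. Suc (k i) choose Suc i)
      = (\<Sum>i=Suc j..Suc t. Suc (k (i - 1)) choose i)"
    by (simp only: sum.shift_bounds_cl_Suc_ivl diff_Suc_1)
  ultimately show ?thesis
    using assms by (simp add: binomial_expansion_def del: binomial_Suc_Suc)
qed

text \<open>The leading numerator confines both the number and its Macaulay value between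
  consecutive binomials, so different leading numerators settle the comparison. Equal leading terms
  are split off, which leaves the claim in base \<open>t\<close>.\<close>

lemma binomial_expansion_shift_mono:
  assumes "binomial_expansion t a j k" "binomial_expansion t b j' k'" "a \<le> b"
  shows "(\<Sum>i=j..t. Suc (k i) choose Suc i) \<le> (\<Sum>i=j'..t. Suc (k' i) choose Suc i)"
  using assms
proof (induction t arbitrary: a b)
  case 0
  then show ?case unfolding binomial_expansion_def by linarith
next
  case (Suc t)
  let ?S = "\<lambda>j k t. \<Sum>i=j..t. Suc (k i) choose Suc i"
  note top = binomial_expansion_top[OF Suc.prems(1)] binomial_expansion_top[OF Suc.prems(2)]
  note top' = binomial_expansion_top[OF binomial_expansion_shift[OF Suc.prems(1)]]
    binomial_expansion_top[OF binomial_expansion_shift[OF Suc.prems(2)]]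
  consider "k (Suc t) < k' (Suc t)" | "k (Suc t) = k' (Suc t)" | "k' (Suc t) < k (Suc t)"
    by linarith
  then show ?case
  proof cases
    case 1
    then have "Suc (Suc (k (Suc t))) choose Suc (Suc t) \<le> Suc (k' (Suc t)) choose Suc (Suc t)"
      by (intro binomial_right_mono) simp
    with top' show ?thesis by (simp del: binomial_Suc_Suc)
  next
    case 2
    show ?thesis
    proof (cases "j \<le> t")
      case True
      note s = binomial_expansion_Suc[OF Suc.prems(1) True]
      \<comment> \<open>Otherwise \<open>b\<close> would be the common leading binomial alone, while
        \<open>a\<close> has a positive remainder beyond it.\<close>
      have T': "j' \<le> t"
      proof (rule ccontr)
        assume "\<not> j' \<le> t"
        then have "b = (k' (Suc t) choose Suc t)"
          using Suc.prems(2) by (auto simp: binomial_expansion_def le_Suc_eq)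
        then show False using s(3) 2 Suc.prems(3) by simp
      qed
      have "?S j k t \<le> ?S j' k' t"
        using Suc.IH[OF s(1) binomial_expansion_Suc(1)[OF Suc.prems(2) T']] 2 Suc.prems(3) by simp
      then show ?thesis using True T' 2 by (simp del: binomial_Suc_Suc)
    next
      case False
      \<comment> \<open>With a single term, the value for \<open>a\<close> is exactly the lower
        bound that \<open>top'\<close> gives for \<open>b\<close>.\<close>
      then have "?S j k (Suc t) = Suc (k (Suc t)) choose Suc (Suc t)"
        using Suc.prems(1) by (auto simp: binomial_expansion_def le_Suc_eq)
      then show ?thesis using top' 2 by (simp del: binomial_Suc_Suc)
    qed
  next
    case 3
    then have "Suc (k' (Suc t)) choose Suc t \<le> k (Suc t) choose Suc t"
      by (intro binomial_right_mono) simp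
    with top Suc.prems(3) show ?thesis by linarith
  qed
qed

lemma macaulay_mono:
  assumes "1 \<le> t" "a \<le> b"
  shows "macaulay t a \<le> macaulay t b"
proof (cases "a = 0")
  case True
  then show ?thesis by (simp add: macaulay_def)
next
  case False
  then obtain j k j' k' where "binomial_expansion t a j k" "binomial_expansion t b j' k'"
    using binomial_expansion_exists[of t a] binomial_expansion_exists[of t b] assms by auto
  from binomial_expansion_shift_mono[OF this assms(2)] macaulay_eq[OF this(1)] macaulay_eq[OF this(2)]
  show ?thesis using False assms(2) by simp
qed

text \<open>Truncated subtraction makes the weight \<open>i - 1\<close> vanish at 0 and 1, so the
  genus becomes a weighted sum over the same range as the multiplicity.\<close>

lemma genus_O_seqs:
  assumes "h \<in> O_seqs d s"
  shows "genus h = (\<Sum>i<s. (i - 1) * h i)"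
proof -
  have "O_length h = s" using assms by (simp add: O_seqs_def)
  then show ?thesis
    unfolding genus_def by (auto intro!: sum.mono_neutral_left)
qed

lemma genus_not_maximal:
  assumes s: "1 \<le> s" and k: "k \<in> O_seqs d s" and m: "m \<in> O_seqs d s" and less: "O_less k m"
  shows "\<exists>k'\<in>O_seqs d s. genus k < genus k'"
proof -
  have kO: "k 0 = 1" "\<And>t. 1 \<le> t \<Longrightarrow> k (t + 1) \<le> macaulay t (k t)"
    and ks: "k (s - 1) \<noteq> 0" "\<And>i. s \<le> i \<Longrightarrow> k i = 0" "(\<Sum>i<s. k i) = d"
    using k s by (auto simp: O_seqs_iff O_sequence_def)
  have mO: "m 0 = 1" "\<And>t. 1 \<le> t \<Longrightarrow> m (t + 1) \<le> macaulay t (m t)"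
    and ms: "\<And>i. s \<le> i \<Longrightarrow> m i = 0" "(\<Sum>i<s. m i) = d"
    using m s by (auto simp: O_seqs_iff O_sequence_def)
  obtain l where l: "k l < m l" "\<And>i. l < i \<Longrightarrow> k i = m i"
    using less O_less_iff[OF s k m] by blast
  have ls: "l < s" using l(1) ms(1)[of l] by (cases "l < s") auto
  have "\<exists>i. m i < k i"
  \<comment> \<open>Both sequences sum to \<open>d\<close>, so the deficit of \<open>k\<close> at
    \<open>l\<close> must be balanced by an excess elsewhere.\<close>
  proof (rule ccontr)
    assume "\<nexists>i. m i < k i"
    then have "(\<Sum>i<s. k i) < (\<Sum>i<s. m i)"
      using l(1) ls by (intro sum_strict_mono_ex1) (auto simp: not_less)
    then show False using ks(3) ms(2) by simp
  qed
  then obtain i0 where i0: "m i0 < k i0" ..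
  have bd: "i \<le> l" if "m i < k i" for i using l(2)[of i] that by (cases "i \<le> l") auto
  define j where "j = (GREATEST i. m i < k i)"
  have j: "m j < k j" unfolding j_def using GreatestI_nat[of "\<lambda>i. m i < k i"] i0 bd by blast
  have above: "k i \<le> m i" if "j < i" for i
    using Greatest_le_nat[of "\<lambda>i. m i < k i" i l] bd that unfolding j_def
    by (metis leD not_le_imp_less)
  have jl: "j < l" using bd[OF j] j l(1) by (cases "j = l") auto
  define q where "q = (LEAST i. j < i \<and> k i < m i)"
  have q: "j < q" "k q < m q"
    using LeastI[of "\<lambda>i. j < i \<and> k i < m i" l] l(1) jl unfolding q_def by auto
  have between: "k i = m i" if "j < i" "i < q" for i
    using not_less_Least[of i "\<lambda>i. j < i \<and> k i < m i"] above[of i] that unfolding q_def by auto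
  have qs: "q < s" using q(2) ms(1)[of q] by (cases "q < s") auto
  have j1: "1 \<le> j" using j kO(1) mO(1) by (cases j) auto
  define k' where "k' = k(j := k j - 1, q := k q + 1)"
  have "k' (t + 1) \<le> macaulay t (k' t)" if t: "1 \<le> t" for t
  \<comment> \<open>For \<open>t\<close> from \<open>j\<close> to \<open>q - 1\<close>,
    \<open>k'\<close> is at least \<open>m\<close> at \<open>t\<close> and at most \<open>m\<close>
    at \<open>t + 1\<close>, so the growth bound of \<open>m\<close> carries over. For all other
    \<open>t\<close> the bound of \<open>k\<close> suffices, since only its left side can drop or
    its right side grow.\<close>
  proof (cases "j \<le> t \<and> t < q")
    case True
    have "k' (t + 1) \<le> m (t + 1)"
      using True q above[of "t + 1"] by (auto simp: k'_def)
    also have "\<dots> \<le> macaulay t (m t)" by (rule mO(2)[OF t])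
    also have "\<dots> \<le> macaulay t (k' t)"
      using True j between[of t] by (intro macaulay_mono t) (auto simp: k'_def)
    finally show ?thesis .
  next
    case False
    have "k' (t + 1) \<le> k (t + 1)" using False q(1) by (auto simp: k'_def)
    also have "\<dots> \<le> macaulay t (k t)" by (rule kO(2)[OF t])
    also have "\<dots> \<le> macaulay t (k' t)"
      using False q(1) by (intro macaulay_mono t) (auto simp: k'_def)
    finally show ?thesis .
  qed
  \<comment> \<open>Constant weight 1 shows that the multiplicity is kept; weight
    \<open>i - 1\<close> measures the gain in genus.\<close>
  moreover have move: "(\<Sum>i<s. w i * k' i) + w j = (\<Sum>i<s. w i * k i) + w q" for w :: "nat \<Rightarrow> nat"
  proof -
    have "(\<Sum>i<s. w i * k' i) + (\<Sum>i<s. if i = j then w i else 0)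
        = (\<Sum>i<s. w i * k i) + (\<Sum>i<s. if i = q then w i else 0)"
      unfolding sum.distrib[symmetric]
    proof (rule sum.cong)
      fix i
      have "w j * (k j - 1) + w j = w j * k j" using j by (cases "k j") auto
      then show "w i * k' i + (if i = j then w i else 0) = w i * k i + (if i = q then w i else 0)"
        using q(1) by (simp add: k'_def)
    qed simp
    then show ?thesis using q(1) qs by simp
  qed
  \<comment> \<open>Since \<open>1 \<le> j\<close> and \<open>j < q \<le> s - 1\<close>, neither the
    entry 1 in degree 0 nor the last entry is lowered.\<close>
  ultimately have k': "k' \<in> O_seqs d s"
    using kO(1) ks move[of "\<lambda>_. 1"] q(1) qs j1 s by (auto simp: O_seqs_iff O_sequence_def k'_def)
  have "genus k < genus k'"
    using move[of "\<lambda>i. i - 1"] q(1) j1 by (simp add: genus_O_seqs[OF k] genus_O_seqs[OF k'])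
  with k' show ?thesis by blast
qed

theorem theorem3p2:
  fixes d s :: nat
  assumes "d > 2" and "2 \<le> s" and "s \<le> d"
  shows "(\<forall>h\<in>O_seqs d s. \<forall>k\<in>O_seqs d s.
            O_less k h \<and> genus k > genus h \<longrightarrow>
            (\<exists>h'\<in>O_seqs d s. O_less h h' \<and> genus h' > genus k))
       \<and> Max (genera d s) = genus (O_max d s)"
proof -
  have s: "1 \<le> s" using assms by simp
  note fin = finite_O_seqs[OF s, of d]
  define m where "m = O_max d s"
  have m: "m \<in> O_seqs d s" and top: "\<And>h. h \<in> O_seqs d s \<Longrightarrow> h \<noteq> m \<Longrightarrow> O_less h m"
    using theI'[OF O_max_unique[OF assms(2,3)]] unfolding m_def O_max_def by auto
  have "Max (genera d s) \<in> genera d s"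
    using fin m unfolding genera_def by (intro Max_in) auto
  then obtain x where x: "x \<in> O_seqs d s" "Max (genera d s) = genus x"
    unfolding genera_def by auto
  have le: "genus h \<le> genus x" if "h \<in> O_seqs d s" for h
    using that fin x(2) unfolding genera_def by (metis Max_ge finite_imageI imageI)
  \<comment> \<open>A maximiser other than \<open>m\<close> would lie below \<open>m\<close> and
    could be improved.\<close>
  have xm: "x = m"
    using genus_not_maximal[OF s x(1) m] top[OF x(1)] le by (meson leD)
  have lt: "genus h < genus m" if "h \<in> O_seqs d s" "h \<noteq> m" for h
    using genus_not_maximal[OF s that(1) m top[OF that]] le unfolding xm by (meson less_le_trans)
  show ?thesis
  proof (intro conjI ballI impI)
    fix h k
    assume hk: "h \<in> O_seqs d s" "k \<in> O_seqs d s" "O_less k h \<and> genus h < genus k"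
    have "h \<noteq> m" using le[OF hk(2)] hk(3) xm by auto
    \<comment> \<open>\<open>k\<close> lies below \<open>h\<close>, which lies below
      \<open>m\<close>.\<close>
    moreover from this have "k \<noteq> m"
      using hk top[OF hk(1)] O_less_linear[OF s hk(1) m] by auto
    ultimately show "\<exists>h'\<in>O_seqs d s. O_less h h' \<and> genus k < genus h'"
      using m top[OF hk(1)] lt[OF hk(2)] by blast
  qed (use x xm m_def in simp)
qed

end
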